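(* Let $W$ be a Coxeter group of finite rank and let $r$ be a fundamental reflection of $W$. Then the sets $\Delta_1(r)$ and $\mathcal{I}(W)\setminus(\{r\}\cup\Delta_1(r))$ have the same cardinality.
   Context: $W$ is a Coxeter group with set $R$ of fundamental (simple) reflections and length function $\ell$ with respect to $R$. $\mathcal{I}(W)$ is the set of elements of $W$ of order exactly $2$. The excess zero graph $\mathcal{E}_0(W)$ has vertex set $\mathcal{I}(W)$, with $x,y$ adjacent whenever $\ell(xy)=\ell(x)+\ell(y)$. For $x\in\mathcal{I}(W)$, $\Delta_1(x)=\{y\in\mathcal{I}(W) : \ell(xy)=\ell(x)+\ell(y)\}$ is the set of neighbours of $x$. *)

theory Defs
  imports
    "HOL-Algebra.Generated_Groups"
    "HOL-Algebra.Multiplicative_Group"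
    "HOL-Library.Equipollence"
    "HOL-Library.Extended_Nat"
begin

section \<open>Group presentations\<close>

text \<open>
  The library has no free groups, so a presentation is expressed through words in signed
  letters: \<open>(x, True)\<close> stands for \<open>x\<close> and \<open>(x, False)\<close> for its formal inverse.
\<close>

type_synonym 'a signed_word = "('a \<times> bool) list"

definition signed_words :: "'a set \<Rightarrow> 'a signed_word set" where
  "signed_words S = lists (S \<times> UNIV)"

definition word_value :: "('a, 'b) monoid_scheme \<Rightarrow> 'a signed_word \<Rightarrow> 'a" where
  "word_value G w =
     foldr (\<lambda>(x, b) g. (if b then x else inv\<^bsub>G\<^esub> x) \<otimes>\<^bsub>G\<^esub> g) w \<one>\<^bsub>G\<^esub>"

text \<open>
  Equality in the abstract group with generators \<open>S\<close> and relators \<open>Rel\<close>: the congruence on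
  signed words generated by free cancellation and by deletion of relators.
\<close>

inductive pres_eq :: "'a set \<Rightarrow> 'a signed_word set \<Rightarrow> 'a signed_word \<Rightarrow> 'a signed_word \<Rightarrow> bool"
  for S :: "'a set" and Rel :: "'a signed_word set" where
  refl: "w \<in> signed_words S \<Longrightarrow> pres_eq S Rel w w"
| sym: "pres_eq S Rel v w \<Longrightarrow> pres_eq S Rel w v"
| trans: "pres_eq S Rel u v \<Longrightarrow> pres_eq S Rel v w \<Longrightarrow> pres_eq S Rel u w"
| cancel: "u \<in> signed_words S \<Longrightarrow> v \<in> signed_words S \<Longrightarrow> x \<in> S \<Longrightarrow>
    pres_eq S Rel (u @ [(x, b), (x, \<not> b)] @ v) (u @ v)"
| relator: "u \<in> signed_words S \<Longrightarrow> v \<in> signed_words S \<Longrightarrow> q \<in> Rel \<Longrightarrow>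
    pres_eq S Rel (u @ q @ v) (u @ v)"

text \<open>\<open>G = \<langle>S | Rel\<rangle>\<close>, where the generators \<open>S\<close> are elements of \<open>G\<close>.\<close>

definition has_presentation ::
  "('a, 'b) monoid_scheme \<Rightarrow> 'a set \<Rightarrow> 'a signed_word set \<Rightarrow> bool" where
  "has_presentation G S Rel \<longleftrightarrow>
     group G \<and> S \<subseteq> carrier G \<and> Rel \<subseteq> signed_words S \<and> generate G S = carrier G \<and>
     (\<forall>v \<in> signed_words S. \<forall>w \<in> signed_words S.
        word_value G v = word_value G w \<longleftrightarrow> pres_eq S Rel v w)"


section \<open>Coxeter groups\<close>

definition coxeter_matrix :: "'a set \<Rightarrow> ('a \<Rightarrow> 'a \<Rightarrow> enat) \<Rightarrow> bool" where
  "coxeter_matrix R m \<longleftrightarrow>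
     (\<forall>s \<in> R. m s s = 1) \<and>
     (\<forall>s \<in> R. \<forall>t \<in> R. m s t = m t s) \<and>
     (\<forall>s \<in> R. \<forall>t \<in> R. s \<noteq> t \<longrightarrow> 2 \<le> m s t)"

text \<open>The relators \<open>(st)\<^sup>m\<close> for \<open>m = m s t < \<infinity>\<close>; an entry \<open>\<infinity>\<close> imposes no relation.\<close>

definition coxeter_relators :: "'a set \<Rightarrow> ('a \<Rightarrow> 'a \<Rightarrow> enat) \<Rightarrow> 'a signed_word set" where
  "coxeter_relators R m =
     {concat (replicate k [(s, True), (t, True)]) | s t k. s \<in> R \<and> t \<in> R \<and> m s t = enat k}"

text \<open>\<open>W\<close> is a Coxeter group with set \<open>R\<close> of fundamental reflections (of arbitrary rank).\<close>

definition coxeter_group :: "('a, 'b) monoid_scheme \<Rightarrow> 'a set \<Rightarrow> bool" where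
  "coxeter_group W R \<longleftrightarrow>
     (\<exists>m. coxeter_matrix R m \<and> has_presentation W R (coxeter_relators R m))"

text \<open>
  As fundamental reflections are their own inverses, unsigned words in \<open>R\<close> suffice here.
\<close>

definition coxeter_length :: "('a, 'b) monoid_scheme \<Rightarrow> 'a set \<Rightarrow> 'a \<Rightarrow> nat" where
  "coxeter_length W R x =
     (LEAST n. \<exists>w \<in> lists R. length w = n \<and> foldr (\<otimes>\<^bsub>W\<^esub>) w \<one>\<^bsub>W\<^esub> = x)"


section \<open>The excess zero graph\<close>

definition involutions :: "('a, 'b) monoid_scheme \<Rightarrow> 'a set" where
  "involutions W = {x \<in> carrier W. group.ord W x = 2}"

text \<open>
  The set \<open>\<Delta>\<^sub>1(x)\<close> of neighbours of an involution \<open>x\<close> in the excess zero graph.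
\<close>

definition excess_zero_nbrs :: "('a, 'b) monoid_scheme \<Rightarrow> 'a set \<Rightarrow> 'a \<Rightarrow> 'a set" where
  "excess_zero_nbrs W R x =
     {y \<in> involutions W.
        coxeter_length W R (x \<otimes>\<^bsub>W\<^esub> y) = coxeter_length W R x + coxeter_length W R y}"

end

theory Submission
  imports Defs
begin

text \<open>
  The bijection sends an involution \<open>y\<close> to \<open>ry\<close> if \<open>r\<close> and \<open>y\<close> commute and to \<open>ryr\<close>
  otherwise. It is its own inverse, and it exchanges the two sets because \<open>ry \<noteq> yr\<close> forces
  \<open>\<ell>(ryr) = \<ell>(y) \<plusminus> 2\<close>. The latter is a consequence of the exchange condition, which is
  obtained from the presentation as follows: to a word \<open>s\<^sub>1\<dots>s\<^sub>k\<close> assign the list of the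
  reflections \<open>s\<^sub>1\<dots>s\<^sub>i\<dots>s\<^sub>1\<close>. A relator contributes a list of the form \<open>l l\<close>, so the parity of
  the number of occurrences of a given element depends only on the value of the word.
\<close>

section \<open>Words and their lists of reflections in an arbitrary group\<close>

context group
begin

abbreviation list_prod :: "'a list \<Rightarrow> 'a" where
  "list_prod w \<equiv> foldr (\<otimes>) w \<one>"

definition conjg :: "'a \<Rightarrow> 'a \<Rightarrow> 'a" where
  "conjg g x = g \<otimes> x \<otimes> inv g"

text \<open>A letter \<open>s\<close> after a prefix \<open>u\<close> contributes
  \<open>conjg (list_prod u) s\<close>. For letters that are involutions this is the palindrome
  ending in the mirrored prefix.\<close>

fun word_reflections :: "'a list \<Rightarrow> 'a list" where
  "word_reflections [] = []"
| "word_reflections (s # w) = s # map (conjg s) (word_reflections w)"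

lemma list_prod_closed: "set w \<subseteq> carrier G \<Longrightarrow> list_prod w \<in> carrier G"
  by (induction w) auto

lemma list_prod_append:
  "set u \<subseteq> carrier G \<Longrightarrow> set v \<subseteq> carrier G \<Longrightarrow>
    list_prod (u @ v) = list_prod u \<otimes> list_prod v"
  by (induction u) (auto simp: m_assoc list_prod_closed)

lemma conjg_closed [simp]: "g \<in> carrier G \<Longrightarrow> x \<in> carrier G \<Longrightarrow> conjg g x \<in> carrier G"
  by (simp add: conjg_def)

lemma conjg_one [simp]: "x \<in> carrier G \<Longrightarrow> conjg \<one> x = x"
  by (simp add: conjg_def)

lemma conjg_mult:
  "\<lbrakk>g \<in> carrier G; h \<in> carrier G; x \<in> carrier G\<rbrakk> \<Longrightarrow> conjg (g \<otimes> h) x = conjg g (conjg h x)"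
  by (simp add: conjg_def inv_mult_group m_assoc)

lemma set_word_reflections: "set w \<subseteq> carrier G \<Longrightarrow> set (word_reflections w) \<subseteq> carrier G"
  by (induction w) auto

text \<open>A cocycle rule: the prefix acts on the later entries only through its value. Hence
  inserting a factor of value \<open>\<one>\<close> leaves the entries of all later letters
  unchanged.\<close>

lemma word_reflections_append:
  assumes "set u \<subseteq> carrier G" "set v \<subseteq> carrier G"
  shows "word_reflections (u @ v)
    = word_reflections u @ map (conjg (list_prod u)) (word_reflections v)"
  using assms
proof (induction u)
  case Nil
  then show ?case
    using set_word_reflections[of v] by (auto intro!: map_idI[symmetric])
next
  case (Cons s u)
  then show ?case
    using set_word_reflections[of v] by (auto simp: conjg_mult list_prod_closed)
qed

lemma in_word_reflectionsE:
  assumes "set w \<subseteq> carrier G" "t \<in> set (word_reflections w)"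
  obtains u s v where "w = u @ s # v" "t = conjg (list_prod u) s"
  using assms
proof (induction w arbitrary: t thesis)
  case Nil
  then show ?case by simp
next
  case (Cons a w)
  consider "t = a" | t' where "t' \<in> set (word_reflections w)" "t = conjg a t'"
    using Cons.prems by auto
  then show ?case
  proof cases
    case 1
    then show ?thesis
      using Cons.prems(1)[of "[]" a w] Cons.prems(2) by simp
  next
    case 2
    obtain u s v where "w = u @ s # v" "t' = conjg (list_prod u) s"
      using Cons.IH[of t'] 2 Cons.prems by auto
    then show ?thesis
      using Cons.prems(1)[of "a # u" s v] Cons.prems(2) 2
      by (auto simp: conjg_mult list_prod_closed)
  qed
qed

section \<open>Alternating words in two involutions\<close>

text \<open>In the dihedral group generated by \<open>s\<close> and \<open>t\<close>, the element
  \<open>s\<close> inverts \<open>a = s \<otimes> t\<close>, so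
  \<open>s \<otimes> inv a = a \<otimes> s\<close>. Each conjugation by \<open>a\<close> therefore
  raises the exponent by 2.\<close>

lemma conjg_power_involution:
  fixes i j :: nat
  assumes "s \<in> carrier G" "t \<in> carrier G" "s \<otimes> s = \<one>" "t \<otimes> t = \<one>"
  shows "conjg ((s \<otimes> t) [^] i) ((s \<otimes> t) [^] j \<otimes> s) = (s \<otimes> t) [^] (2 * i + j) \<otimes> s"
proof (induction i arbitrary: j)
  case 0
  then show ?case using assms by simp
next
  case (Suc i)
  let ?a = "s \<otimes> t"
  have inv: "inv s = s" "inv t = t"
    using assms inv_equality by auto
  have "conjg ?a (?a [^] j \<otimes> s) = ?a \<otimes> ?a [^] j \<otimes> (?a \<otimes> s)"
    using assms by (simp add: conjg_def inv_mult_group inv m_assoc)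
  also have "\<dots> = ?a [^] (j + 2) \<otimes> s"
    using assms by (simp add: m_assoc[symmetric] nat_pow_Suc2[symmetric] numeral_2_eq_2)
  finally have "conjg ?a (?a [^] j \<otimes> s) = ?a [^] (j + 2) \<otimes> s" .
  then have "conjg (?a [^] Suc i) (?a [^] j \<otimes> s) = conjg (?a [^] i) (?a [^] (j + 2) \<otimes> s)"
    using assms by (simp add: conjg_mult)
  then show ?case
    using Suc.IH[of "j + 2"] by simp
qed

lemma list_prod_alternating:
  assumes "s \<in> carrier G" "t \<in> carrier G"
  shows "list_prod (concat (replicate k [s, t])) = (s \<otimes> t) [^] k"
proof (induction k)
  case (Suc k)
  then show ?case
    using assms nat_pow_Suc2[of "s \<otimes> t" k] by (simp add: m_assoc del: nat_pow_Suc)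
qed simp

text \<open>The two letters of block number \<open>i\<close>, counted from 0, contribute the
  conjugates by the \<open>i\<close>-th power of \<open>s \<otimes> t\<close> of \<open>s\<close>
  and of \<open>conjg s t = (s \<otimes> t) \<otimes> s\<close>. By
  \<open>conjg_power_involution\<close> these have exponents \<open>2 * i\<close> and
  \<open>2 * i + 1\<close>.\<close>

lemma word_reflections_alternating:
  assumes "s \<in> carrier G" "t \<in> carrier G" "s \<otimes> s = \<one>" "t \<otimes> t = \<one>"
  shows "word_reflections (concat (replicate k [s, t]))
    = map (\<lambda>i. (s \<otimes> t) [^] i \<otimes> s) [0..<2 * k]"
proof (induction k)
  case (Suc k)
  let ?a = "s \<otimes> t"
  have rep: "concat (replicate (Suc k) [s, t]) = concat (replicate k [s, t]) @ [s, t]"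
    by (simp only: replicate_Suc replicate_append_same[symmetric]) simp
  have inv: "inv s = s"
    using assms inv_equality by auto
  have "set (concat (replicate k [s, t])) \<subseteq> carrier G"
    using assms by auto
  then have "word_reflections (concat (replicate (Suc k) [s, t]))
    = map (\<lambda>i. ?a [^] i \<otimes> s) [0..<2 * k] @ [conjg (?a [^] k) s, conjg (?a [^] k) (conjg s t)]"
    using assms unfolding rep
    by (subst word_reflections_append) (auto simp: Suc list_prod_alternating)
  moreover have "conjg (?a [^] k) s = ?a [^] (2 * k) \<otimes> s"
    using conjg_power_involution[OF assms, of k 0] assms by simp
  moreover have "conjg (?a [^] k) (conjg s t) = ?a [^] (2 * k + 1) \<otimes> s"
    using conjg_power_involution[OF assms, of k 1] assms by (simp add: conjg_def inv)
  ultimately show ?case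
    by simp
qed simp

text \<open>The powers of \<open>s \<otimes> t\<close> repeat with period \<open>k\<close>, so the
  \<open>2 * k\<close> reflections are one block of \<open>k\<close> taken twice. Here
  \<open>k\<close> may be any exponent that kills \<open>s \<otimes> t\<close>, not just its
  order.\<close>

lemma word_reflections_alternating_double:
  assumes "s \<in> carrier G" "t \<in> carrier G" "s \<otimes> s = \<one>" "t \<otimes> t = \<one>"
    and "(s \<otimes> t) [^] k = \<one>"
  obtains l where "word_reflections (concat (replicate k [s, t])) = l @ l"
proof
  let ?f = "\<lambda>i. (s \<otimes> t) [^] (i::nat) \<otimes> s"
  have "map ?f [0..<k + k] = map ?f [0..<k] @ map (\<lambda>i. ?f (k + i)) [0..<k]"
    by (subst upt_add_eq_append) (auto simp: map_add_upt[symmetric] add.commute o_def)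
  also have "map (\<lambda>i. ?f (k + i)) [0..<k] = map ?f [0..<k]"
    using assms by (auto simp: nat_pow_mult[symmetric])
  finally show "word_reflections (concat (replicate k [s, t])) = map ?f [0..<k] @ map ?f [0..<k]"
    using word_reflections_alternating[OF assms(1-4), of k] by (simp add: mult_2)
qed

lemma ord_eq_2_iff:
  assumes "x \<in> carrier G"
  shows "ord x = 2 \<longleftrightarrow> x \<noteq> \<one> \<and> x \<otimes> x = \<one>"
proof -
  have "x \<otimes> x = \<one> \<longleftrightarrow> ord x dvd 2"
    using pow_eq_id[OF assms, of 2] assms by (simp add: numeral_2_eq_2)
  moreover have "x = \<one> \<longleftrightarrow> ord x = 1"
    using assms ord_eq_1 by auto
  moreover have "n dvd 2 \<longleftrightarrow> n = 1 \<or> n = 2" for n :: nat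
    using dvd_imp_le[of n 2] by (auto simp: le_Suc_eq numeral_2_eq_2)
  ultimately show ?thesis by auto
qed

end

section \<open>Coxeter groups: relators and parity invariants of words\<close>

locale coxeter = group G for G :: "('a, 'b) monoid_scheme" (structure) +
  fixes R :: "'a set"
  assumes coxeter: "coxeter_group G R"
begin

abbreviation len :: "'a \<Rightarrow> nat" where
  "len \<equiv> coxeter_length G R"

lemma R_closed: "R \<subseteq> carrier G"
  using coxeter unfolding coxeter_group_def has_presentation_def by blast

lemma words_closed: "w \<in> lists R \<Longrightarrow> set w \<subseteq> carrier G"
  using R_closed by auto

lemma list_prod_word_closed [simp]: "w \<in> lists R \<Longrightarrow> list_prod w \<in> carrier G"
  using words_closed list_prod_closed by blast

lemma word_value_positive: "word_value G (map (\<lambda>s. (s, True)) w) = list_prod w"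
  by (induction w) (auto simp: word_value_def)

lemma relator_value:
  assumes "has_presentation G R Rel" "q \<in> Rel"
  shows "word_value G q = \<one>"
proof -
  have "q \<in> signed_words R" "[] \<in> signed_words R"
    using assms unfolding has_presentation_def by (auto simp: signed_words_def)
  moreover have "pres_eq R Rel q []"
    using pres_eq.relator[of "[]" R "[]" q Rel] assms by (simp add: signed_words_def)
  ultimately have "word_value G q = word_value G []"
    using assms unfolding has_presentation_def by blast
  then show ?thesis by (simp add: word_value_def)
qed

lemma coxeter_relator_value:
  assumes "has_presentation G R (coxeter_relators R m)" "s \<in> R" "t \<in> R" "m s t = enat k"
  shows "(s \<otimes> t) [^] k = \<one>"
proof -
  let ?q = "concat (replicate k [(s, True), (t, True)])"
  have eq: "?q = map (\<lambda>s. (s, True)) (concat (replicate k [s, t]))"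
    by (simp add: map_concat)
  have "?q \<in> coxeter_relators R m"
    using assms unfolding coxeter_relators_def by blast
  then have "list_prod (concat (replicate k [s, t])) = \<one>"
    using relator_value[OF assms(1), of ?q] unfolding eq word_value_positive by blast
  then show ?thesis
    using list_prod_alternating R_closed assms by (metis subsetD)
qed

text \<open>The diagonal entry \<open>m s s = 1\<close> makes the word \<open>s s\<close> a
  relator.\<close>

lemma simple_square: "s \<in> R \<Longrightarrow> s \<otimes> s = \<one>"
proof -
  assume s: "s \<in> R"
  obtain m where m: "coxeter_matrix R m" "has_presentation G R (coxeter_relators R m)"
    using coxeter unfolding coxeter_group_def by blast
  have "m s s = enat 1"
    using m s by (simp add: coxeter_matrix_def one_enat_def)
  then have "(s \<otimes> s) [^] (1::nat) = \<one>"
    using coxeter_relator_value[OF m(2) s s] by blast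
  then show ?thesis
    using s R_closed by auto
qed

lemma simple_inv: "s \<in> R \<Longrightarrow> inv s = s"
  using simple_square R_closed inv_equality by blast

text \<open>
  Signs are dropped by \<open>map fst\<close>, which is harmless because simple reflections are their own
  inverses.
\<close>

lemma word_invariants:
  assumes m: "has_presentation G R (coxeter_relators R m)"
    and "pres_eq R (coxeter_relators R m) v w"
  shows "even (length v) = even (length w) \<and>
    even (count_list (word_reflections (map fst v)) t)
      = even (count_list (word_reflections (map fst w)) t)"
  using assms(2)
proof (induction rule: pres_eq.induct)
  case (cancel u v x b)
  have sets: "set (map fst u) \<subseteq> carrier G" "set (map fst v) \<subseteq> carrier G" "x \<in> carrier G"
    using cancel R_closed by (auto simp: signed_words_def)
  \<comment> \<open>The cancelled pair contributes \<open>x\<close> twice and has value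
    \<open>\<one>\<close>, so it does not disturb the entries of \<open>v\<close>.\<close>
  have "conjg x x = x" "x \<otimes> x = \<one>"
    using sets cancel by (auto simp: conjg_def m_assoc simple_square simple_inv)
  then show ?case
    using sets set_word_reflections[OF sets(2)]
    by (auto simp: word_reflections_append conjg_mult[symmetric] subset_iff cong: map_cong)
next
  case (relator u v q)
  obtain s t k where st: "s \<in> R" "t \<in> R" "m s t = enat k"
    and q: "q = concat (replicate k [(s, True), (t, True)])"
    using relator unfolding coxeter_relators_def by blast
  have q': "map fst q = concat (replicate k [s, t])"
    by (simp add: q map_concat)
  have sets: "set (map fst u) \<subseteq> carrier G" "set (map fst v) \<subseteq> carrier G"
    "s \<in> carrier G" "t \<in> carrier G"
    using relator st R_closed by (auto simp: signed_words_def)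
  then have setq: "set (map fst q) \<subseteq> carrier G"
    unfolding q' by auto
  have pow: "(s \<otimes> t) [^] k = \<one>"
    using coxeter_relator_value m st by blast
  obtain l where l: "word_reflections (map fst q) = l @ l"
    using word_reflections_alternating_double[OF sets(3,4) _ _ pow] st simple_square q' by metis
  have prod: "list_prod (map fst q) = \<one>"
    using list_prod_alternating[OF sets(3,4)] pow q' by simp
  \<comment> \<open>Since the relator has value \<open>\<one>\<close>, only the block
    \<open>l @ l\<close> is new. Conjugation by the prefix keeps it a doubled list, so no parity
    changes.\<close>
  have "word_reflections (map fst (q @ v)) = l @ l @ word_reflections (map fst v)"
    using word_reflections_append[OF setq sets(2)] l prod set_word_reflections[OF sets(2)]
    by (auto intro!: map_idI)
  then have "word_reflections (map fst (u @ q @ v)) = word_reflections (map fst u)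
      @ map (conjg (list_prod (map fst u))) (l @ l @ word_reflections (map fst v))"
    using word_reflections_append[OF sets(1), of "map fst (q @ v)"] setq sets(2) by simp
  moreover have "even (length q)"
    unfolding q by (induction k) auto
  ultimately show ?case
    using word_reflections_append[OF sets(1,2)] by auto
qed auto

text \<open>Here the presentation enters in full: words of equal value are linked by cancellations
  and relators, and these preserve both parities.\<close>

lemma equal_prod_invariants:
  assumes "v \<in> lists R" "w \<in> lists R" "list_prod v = list_prod w"
  shows "even (length v) = even (length w)"
    and "even (count_list (word_reflections v) t) = even (count_list (word_reflections w) t)"
proof -
  obtain m where m: "has_presentation G R (coxeter_relators R m)"
    using coxeter unfolding coxeter_group_def by blast
  let ?p = "map (\<lambda>s. (s, True)) :: 'a list \<Rightarrow> 'a signed_word"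
  have "?p v \<in> signed_words R" "?p w \<in> signed_words R"
    using assms by (auto simp: signed_words_def)
  then have "pres_eq R (coxeter_relators R m) (?p v) (?p w)"
    using m assms(3) word_value_positive unfolding has_presentation_def by metis
  from word_invariants[OF m this, of t]
  show "even (length v) = even (length w)"
    "even (count_list (word_reflections v) t) = even (count_list (word_reflections w) t)"
    by (auto simp: o_def)
qed

section \<open>The length function\<close>

lemma word_exists:
  assumes "x \<in> carrier G"
  obtains w where "w \<in> lists R" "list_prod w = x"
proof -
  have "x \<in> generate G R"
    using assms coxeter unfolding coxeter_group_def has_presentation_def by auto
  then have "\<exists>w \<in> lists R. list_prod w = x"
  proof (induction rule: generate.induct)
    case one
    then show ?case by (intro bexI[of _ "[]"]) auto
  next
    case (incl s)
    then show ?case using R_closed by (intro bexI[of _ "[s]"]) auto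
  next
    case (inv s)
    then show ?case using R_closed simple_inv by (intro bexI[of _ "[s]"]) auto
  next
    case (eng x y)
    then obtain u v where "u \<in> lists R" "v \<in> lists R" "list_prod u = x" "list_prod v = y"
      by blast
    then show ?case
      using list_prod_append words_closed by (intro bexI[of _ "u @ v"]) auto
  qed
  then show ?thesis using that by blast
qed

lemma reduced_word_exists:
  assumes "x \<in> carrier G"
  obtains w where "w \<in> lists R" "list_prod w = x" "length w = len x"
proof -
  have "\<exists>n. \<exists>w \<in> lists R. length w = n \<and> list_prod w = x"
    using word_exists[OF assms] by metis
  from LeastI_ex[OF this] show ?thesis
    using that unfolding coxeter_length_def by blast
qed

lemma len_le: "w \<in> lists R \<Longrightarrow> len (list_prod w) \<le> length w"
  unfolding coxeter_length_def by (rule Least_le) blast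

lemma even_len: "w \<in> lists R \<Longrightarrow> even (len (list_prod w)) = even (length w)"
  by (metis equal_prod_invariants(1) list_prod_word_closed reduced_word_exists)

text \<open>Parity separates \<open>s\<close> from the empty word, so its length is not 0.\<close>

lemma len_simple: "s \<in> R \<Longrightarrow> len s = 1"
  using len_le[of "[s]"] even_len[of "[s]"] R_closed by (auto simp: le_Suc_eq)

text \<open>Prefixing a letter adds at most 1 to the length, and a second multiplication by
  \<open>s\<close> undoes the first. Parity excludes equal lengths.\<close>

lemma len_mult_simple_cases:
  assumes "s \<in> R" "x \<in> carrier G"
  shows "len (s \<otimes> x) = len x + 1 \<or> len x = len (s \<otimes> x) + 1"
proof -
  have le: "len (s \<otimes> y) \<le> len y + 1" if y: "y \<in> carrier G" for y
  proof -
    obtain w where "w \<in> lists R" "list_prod w = y" "length w = len y"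
      using reduced_word_exists[OF y] .
    then show ?thesis using len_le[of "s # w"] assms by auto
  qed
  have "s \<otimes> (s \<otimes> x) = x"
    using assms R_closed by (simp add: m_assoc[symmetric] simple_square subset_iff)
  then have "len x \<le> len (s \<otimes> x) + 1"
    using le[of "s \<otimes> x"] assms R_closed by auto
  moreover have "len (s \<otimes> x) \<noteq> len x"
  proof -
    obtain w where "w \<in> lists R" "list_prod w = x"
      using word_exists[OF assms(2)] .
    then show ?thesis using even_len[of w] even_len[of "s # w"] assms by auto
  qed
  ultimately show ?thesis using le[of x] assms by linarith
qed

text \<open>Reversing a word inverts its value, because its letters are involutions.\<close>

lemma len_inv:
  assumes "x \<in> carrier G"
  shows "len (inv x) = len x"
proof -
  have rev: "list_prod (rev w) = inv (list_prod w)" if "w \<in> lists R" for w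
    using that
  proof (induction w)
    case (Cons s w)
    have "list_prod (rev w @ [s]) = list_prod (rev w) \<otimes> list_prod [s]"
      using Cons by (intro list_prod_append words_closed) auto
    then show ?case
      using Cons R_closed by (auto simp: inv_mult_group simple_inv subset_iff)
  qed simp
  have le: "len (inv y) \<le> len y" if y: "y \<in> carrier G" for y
  proof -
    obtain w where "w \<in> lists R" "list_prod w = y" "length w = len y"
      using reduced_word_exists[OF y] .
    then show ?thesis using len_le[of "rev w"] rev[of w] by (simp add: in_lists_conv_set)
  qed
  show ?thesis
    using le[of x] le[of "inv x"] assms by simp
qed

section \<open>The exchange condition\<close>

text \<open>With \<open>t\<close> the conjugate of \<open>s\<close> by the value of
  \<open>u\<close>, the product of \<open>t\<close> with \<open>u s v\<close> is
  \<open>u s s v\<close>, and the two letters \<open>s\<close> cancel.\<close>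

lemma reflection_deletes_letter:
  assumes "w \<in> lists R" "t \<in> set (word_reflections w)"
  obtains u s v where "w = u @ s # v" "t \<otimes> list_prod w = list_prod (u @ v)"
proof -
  obtain u s v where w: "w = u @ s # v" and t: "t = conjg (list_prod u) s"
    using in_word_reflectionsE assms words_closed by metis
  have uv: "u \<in> lists R" "v \<in> lists R" "s \<in> R" "s # v \<in> lists R"
    using assms w by auto
  then have c: "list_prod u \<in> carrier G" "list_prod v \<in> carrier G" "s \<in> carrier G"
    using R_closed list_prod_word_closed by blast+
  have ss: "s \<otimes> (s \<otimes> list_prod v) = list_prod v"
    using c simple_square[OF uv(3)] by (simp add: m_assoc[symmetric])
  have "list_prod w = list_prod u \<otimes> (s \<otimes> list_prod v)"
    using list_prod_append[OF words_closed words_closed, OF uv(1) uv(4)] w by simp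
  moreover have "inv (list_prod u) \<otimes> (list_prod u \<otimes> (s \<otimes> list_prod v)) = s \<otimes> list_prod v"
    using c by (simp add: m_assoc[symmetric])
  ultimately have "t \<otimes> list_prod w = list_prod u \<otimes> list_prod v"
    using c ss by (simp add: t conjg_def m_assoc)
  then have "t \<otimes> list_prod w = list_prod (u @ v)"
    using list_prod_append[OF words_closed words_closed, OF uv(1,2)] by simp
  then show ?thesis using that w by blast
qed

text \<open>The word \<open>w\<close> need not be reduced. It is compared with \<open>s # v\<close>,
  where \<open>v\<close> is a reduced word for \<open>s \<otimes> list_prod w\<close>: there
  \<open>s\<close> occurs exactly once among the reflections, hence an odd number of times among
  those of \<open>w\<close>.\<close>

lemma exchange:
  assumes "s \<in> R" "w \<in> lists R" "len (s \<otimes> list_prod w) < len (list_prod w)"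
  obtains u t v where "w = u @ t # v" "s \<otimes> list_prod w = list_prod (u @ v)"
proof -
  have sc: "s \<in> carrier G" using assms R_closed by blast
  have ss: "s \<otimes> (s \<otimes> list_prod w) = list_prod w"
    using assms sc by (simp add: m_assoc[symmetric] simple_square)
  obtain v where v: "v \<in> lists R" "list_prod v = s \<otimes> list_prod w"
    "length v = len (s \<otimes> list_prod w)"
    using reduced_word_exists[of "s \<otimes> list_prod w"] assms sc by auto
  \<comment> \<open>Otherwise deleting a letter of \<open>v\<close> would give a word for
    \<open>list_prod w\<close> shorter than \<open>v\<close>, yet \<open>v\<close> is already
    shorter than \<open>len (list_prod w)\<close>.\<close>
  have "s \<notin> set (word_reflections v)"
  proof
    assume "s \<in> set (word_reflections v)"
    then obtain v1 a v2 where "v = v1 @ a # v2" "s \<otimes> list_prod v = list_prod (v1 @ v2)"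
      using reflection_deletes_letter v(1) by blast
    then show False
      using len_le[of "v1 @ v2"] v ss assms(3) by auto
  qed
  \<comment> \<open>Conjugation by \<open>s\<close> is injective and fixes \<open>s\<close>, so no
    entry coming from \<open>v\<close> turns into \<open>s\<close>.\<close>
  moreover have "s = conjg s x \<longleftrightarrow> x = s" if "x \<in> carrier G" for x
  proof -
    have "conjg s x = s \<longleftrightarrow> conjg s x = conjg s s"
      using sc by (simp add: conjg_def m_assoc)
    then show ?thesis
      using that sc by (auto simp: conjg_def)
  qed
  ultimately have "s \<notin> set (map (conjg s) (word_reflections v))"
    using set_word_reflections[OF words_closed[OF v(1)]] by auto
  then have "count_list (word_reflections (s # v)) s = 1"
    by (simp add: count_list_0_iff)
  moreover have "list_prod (s # v) = list_prod w" "s # v \<in> lists R"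
    using v ss assms by auto
  ultimately have "odd (count_list (word_reflections w) s)"
    using equal_prod_invariants(2)[of "s # v" w s] assms by simp
  then have "s \<in> set (word_reflections w)"
    using count_list_0_iff[of "word_reflections w" s]
    by (cases "s \<in> set (word_reflections w)") auto
  then show ?thesis
    using reflection_deletes_letter assms(2) that by blast
qed

text \<open>Exchange is applied to a reduced word of \<open>x\<close> followed by \<open>t\<close>.
  The deleted letter must be the final \<open>t\<close>, since a deletion inside the word of
  \<open>x\<close> would make \<open>s \<otimes> x\<close> shorter than \<open>x\<close>.\<close>

lemma exchange_two_sided:
  assumes "s \<in> R" "t \<in> R" "x \<in> carrier G"
    and "len x < len (s \<otimes> x)" "len (s \<otimes> (x \<otimes> t)) < len (x \<otimes> t)"
  shows "s \<otimes> x = x \<otimes> t"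
proof -
  have sc: "s \<in> carrier G" "t \<in> carrier G" using assms R_closed by auto
  obtain w where w: "w \<in> lists R" "list_prod w = x" "length w = len x"
    using reduced_word_exists[OF assms(3)] .
  have prod: "list_prod (u @ [t]) = list_prod u \<otimes> t" if "u \<in> lists R" for u
    using list_prod_append[of u "[t]"] words_closed[OF that] sc by simp
  obtain u a v where uv: "w @ [t] = u @ a # v" "s \<otimes> (x \<otimes> t) = list_prod (u @ v)"
    using exchange[of s "w @ [t]"] assms(1,2,5) w(1) prod[OF w(1)] unfolding w(2)
    by (metis append_in_lists_conv lists.simps)
  show ?thesis
  proof (cases v rule: rev_cases)
    \<comment> \<open>The final \<open>t\<close> is deleted, so
      \<open>s \<otimes> x \<otimes> t = x\<close>.\<close>
    case Nil
    then have "s \<otimes> x \<otimes> t = x"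
      using uv w sc assms by (simp add: m_assoc)
    then have "s \<otimes> x \<otimes> t \<otimes> t = x \<otimes> t" by simp
    then show ?thesis
      using sc assms simple_square[OF assms(2)] by (simp add: m_assoc)
  next
    \<comment> \<open>The deleted letter lies in \<open>w\<close>. Cancelling the final
      \<open>t\<close> leaves a word for \<open>s \<otimes> x\<close> with fewer than
      \<open>len x\<close> letters.\<close>
    case (snoc v' b)
    then have w': "w = u @ a # v'" "b = t" using uv by auto
    then have l: "u @ v' \<in> lists R" using w by auto
    have "s \<otimes> x \<otimes> t = list_prod (u @ v') \<otimes> t"
      using uv snoc w' prod[OF l] sc assms by (simp add: m_assoc)
    then have "s \<otimes> x = list_prod (u @ v')"
      using sc assms l by (meson list_prod_word_closed m_closed right_cancel)
    then show ?thesis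
      using len_le[OF l] w w' assms(4) by simp
  qed
qed

section \<open>The twisting map on involutions and the bijection\<close>

text \<open>Conjugation by a simple reflection \<open>r\<close> fixes every \<open>y\<close>
  commuting with it, so it could not move such \<open>y\<close> to the other set; multiplication by
  \<open>r\<close> replaces it there.\<close>

definition twist :: "'a \<Rightarrow> 'a \<Rightarrow> 'a" where
  "twist r y = (if r \<otimes> y = y \<otimes> r then r \<otimes> y else r \<otimes> y \<otimes> r)"

lemma involutions_iff: "y \<in> involutions G \<longleftrightarrow> y \<in> carrier G \<and> y \<noteq> \<one> \<and> y \<otimes> y = \<one>"
  unfolding involutions_def using ord_eq_2_iff by auto

text \<open>As \<open>len r = 1\<close>, additivity means an increase by 1, and by
  \<open>len_mult_simple_cases\<close> every increase is by 1.\<close>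

lemma excess_zero_nbrs_simple_iff:
  assumes "r \<in> R"
  shows "y \<in> excess_zero_nbrs G R r \<longleftrightarrow> y \<in> involutions G \<and> len y < len (r \<otimes> y)"
  using len_mult_simple_cases[OF assms, of y] len_simple[OF assms]
  by (auto simp: excess_zero_nbrs_def involutions_iff)

lemma twist_involution:
  assumes r: "r \<in> R" and y: "y \<in> involutions G" "y \<noteq> r"
  shows "twist r y \<in> involutions G" "twist r y \<noteq> r" "twist r (twist r y) = y"
    and "len y < len (r \<otimes> y) \<longleftrightarrow> len (r \<otimes> twist r y) < len (twist r y)"
proof -
  have rr: "r \<in> carrier G" "r \<otimes> r = \<one>"
    using r R_closed simple_square by auto
  have yy: "y \<in> carrier G" "y \<noteq> \<one>" "y \<otimes> y = \<one>"
    using y by (auto simp: involutions_iff)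
  have rrx: "r \<otimes> (r \<otimes> x) = x" if "x \<in> carrier G" for x
    using that rr by (simp add: m_assoc[symmetric])
  have yyx: "y \<otimes> (y \<otimes> x) = x" if "x \<in> carrier G" for x
    using that yy by (simp add: m_assoc[symmetric])
  \<comment> \<open>For involutions \<open>r\<close> and \<open>y\<close>, the product
    \<open>y \<otimes> r\<close> is the inverse of \<open>r \<otimes> y\<close>.\<close>
  have lenyr: "len (y \<otimes> r) = len (r \<otimes> y)"
    using len_inv[of "r \<otimes> y"] rr yy inv_equality[of r r] inv_equality[of y y]
    by (simp add: inv_mult_group)
  have "twist r y \<in> involutions G \<and> twist r y \<noteq> r \<and> twist r (twist r y) = y \<and>
    (len y < len (r \<otimes> y) \<longleftrightarrow> len (r \<otimes> twist r y) < len (twist r y))"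
  proof (cases "r \<otimes> y = y \<otimes> r")
    case True
    have "r \<otimes> y \<otimes> (r \<otimes> y) = r \<otimes> y \<otimes> (y \<otimes> r)"
      using True by simp
    also have "\<dots> = \<one>"
      using rr yy yyx by (simp add: m_assoc)
    finally have "r \<otimes> y \<otimes> (r \<otimes> y) = \<one>" .
    \<comment> \<open>This is where \<open>y \<noteq> r\<close> is used.\<close>
    moreover have "r \<otimes> y \<noteq> \<one>"
      using rrx[OF yy(1)] y(2) rr by auto
    moreover have "r \<otimes> y \<noteq> r"
      using rr yy by simp
    moreover have "r \<otimes> (r \<otimes> y) = r \<otimes> (y \<otimes> r)"
      using True by simp
    then have "twist r (r \<otimes> y) = y"
      using rr yy rrx[OF yy(1)] by (simp add: twist_def m_assoc)
    moreover have "twist r y = r \<otimes> y"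
      using True by (simp add: twist_def)
    ultimately show ?thesis
      using rr yy rrx[OF yy(1)] by (simp add: involutions_iff)
  next
    case False
    let ?z = "r \<otimes> y \<otimes> r"
    have rz: "r \<otimes> ?z = y \<otimes> r" "?z \<otimes> r = r \<otimes> y"
      using rr yy rrx by (simp_all add: m_assoc)
    have "?z \<otimes> ?z = \<one>"
      using rr yy rrx yyx by (simp add: m_assoc)
    moreover have "?z \<noteq> \<one>"
    proof
      assume "?z = \<one>"
      then have "r = y \<otimes> r"
        using rz rr by simp
      then show False
        using rr yy by simp
    qed
    moreover have "?z \<noteq> r"
    proof
      assume "?z = r"
      then have "y \<otimes> r = r \<otimes> y"
        using rz by simp
      then show False
        using False by simp
    qed
    moreover have "r \<otimes> ?z \<noteq> ?z \<otimes> r"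
      using False rz by simp
    then have "twist r ?z = r \<otimes> ?z \<otimes> r"
      by (simp add: twist_def)
    then have "twist r ?z = y"
      using rr yy rrx[OF yy(1)] by (simp add: m_assoc)
    moreover have "twist r y = ?z"
      using False by (simp add: twist_def)
    moreover have "len y < len (r \<otimes> y) \<longleftrightarrow> len (r \<otimes> ?z) < len ?z"
    proof
      assume up: "len y < len (r \<otimes> y)"
      \<comment> \<open>If \<open>r\<close> shortened \<open>y \<otimes> r\<close>, then
        \<open>exchange_two_sided\<close> would make \<open>r\<close> and \<open>y\<close> commute.
        So \<open>r\<close> lengthens \<open>y \<otimes> r\<close> to \<open>?z\<close>, and
        \<open>r \<otimes> ?z\<close> is \<open>y \<otimes> r\<close> again.\<close>
      have "\<not> len (r \<otimes> (y \<otimes> r)) < len (y \<otimes> r)"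
        using exchange_two_sided[OF r r yy(1) up] False by blast
      then show "len (r \<otimes> ?z) < len ?z"
        using len_mult_simple_cases[OF r, of "y \<otimes> r"] rr yy rz by (auto simp: m_assoc)
    next
      assume down: "len (r \<otimes> ?z) < len ?z"
      show "len y < len (r \<otimes> y)"
      proof (rule ccontr)
        assume "\<not> len y < len (r \<otimes> y)"
        then have "len (r \<otimes> y) < len y"
          using len_mult_simple_cases[OF r yy(1)] by auto
        moreover have "r \<otimes> (y \<otimes> r) = ?z" "y \<otimes> r \<otimes> r = y"
          using rr yy by (simp_all add: m_assoc)
        \<comment> \<open>Now \<open>exchange_two_sided\<close> is used at
          \<open>y \<otimes> r\<close>: by \<open>down\<close>, \<open>r\<close> lengthens it to
          \<open>?z\<close>, while \<open>r\<close> shortens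
          \<open>y \<otimes> r \<otimes> r = y\<close>. The outcome \<open>?z = y\<close> would
          again make \<open>r\<close> and \<open>y\<close> commute.\<close>
        ultimately have "r \<otimes> (y \<otimes> r) = y \<otimes> r \<otimes> r"
          using exchange_two_sided[OF r r, of "y \<otimes> r"] down rz rr yy lenyr by simp
        then show False
          using \<open>r \<otimes> (y \<otimes> r) = ?z\<close> \<open>y \<otimes> r \<otimes> r = y\<close> rz False by metis
      qed
    qed
    ultimately show ?thesis
      using rr yy by (simp add: involutions_iff)
  qed
  then show "twist r y \<in> involutions G" "twist r y \<noteq> r" "twist r (twist r y) = y"
    "len y < len (r \<otimes> y) \<longleftrightarrow> len (r \<otimes> twist r y) < len (twist r y)"
    by blast+
qed

lemma excess_zero_nbrs_eqpoll:
  assumes r: "r \<in> R"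
  shows "excess_zero_nbrs G R r \<approx> involutions G - ({r} \<union> excess_zero_nbrs G R r)"
proof -
  have "r \<notin> excess_zero_nbrs G R r"
  proof
    assume "r \<in> excess_zero_nbrs G R r"
    then have "len (\<one>) = 2"
      using len_simple[OF r] simple_square[OF r] by (simp add: excess_zero_nbrs_def)
    then show False using len_le[of "[]"] by simp
  qed
  then have nbrs: "y \<in> excess_zero_nbrs G R r
      \<longleftrightarrow> y \<in> involutions G \<and> y \<noteq> r \<and> len y < len (r \<otimes> y)" for y
    using excess_zero_nbrs_simple_iff[OF r, of y] by blast
  \<comment> \<open>Lengths never tie, so among the involutions other than \<open>r\<close> the two
    sets are those lengthened and those shortened by \<open>r\<close>.\<close>
  have "len (r \<otimes> y) < len y \<longleftrightarrow> \<not> len y < len (r \<otimes> y)" if "y \<in> involutions G" for y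
    using len_mult_simple_cases[OF r, of y] that by (auto simp: involutions_iff)
  then have compl: "y \<in> involutions G - ({r} \<union> excess_zero_nbrs G R r)
      \<longleftrightarrow> y \<in> involutions G \<and> y \<noteq> r \<and> len (r \<otimes> y) < len y" for y
    using nbrs[of y] by blast
  have "twist r y \<in> involutions G - ({r} \<union> excess_zero_nbrs G R r)"
    if "y \<in> excess_zero_nbrs G R r" for y
    using that twist_involution[OF r, of y] unfolding nbrs compl by blast
  moreover have "twist r y \<in> excess_zero_nbrs G R r"
    if "y \<in> involutions G - ({r} \<union> excess_zero_nbrs G R r)" for y
    using that twist_involution[OF r, of y] twist_involution(3,4)[OF r, of "twist r y"]
    unfolding nbrs compl by metis
  moreover have "twist r (twist r y) = y" if "y \<in> involutions G" "y \<noteq> r" for y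
    using twist_involution(3)[OF r that] .
  \<comment> \<open>Since \<open>twist r\<close> is its own inverse on these involutions, mapping
    each set into the other suffices.\<close>
  ultimately have "bij_betw (twist r) (excess_zero_nbrs G R r)
      (involutions G - ({r} \<union> excess_zero_nbrs G R r))"
    using nbrs compl
    by (intro bij_betw_byWitness[where f' = "twist r"] ballI image_subsetI) blast+
  then show ?thesis unfolding eqpoll_def by blast
qed

end

theorem theorem1p3:
  fixes W :: "('a, 'b) monoid_scheme" and R :: "'a set" and r :: 'a
  assumes "coxeter_group W R"
    and "finite R"
    and "r \<in> R"
  shows "excess_zero_nbrs W R r \<approx> involutions W - ({r} \<union> excess_zero_nbrs W R r)"
proof -
  have "group W"
    using assms(1) unfolding coxeter_group_def has_presentation_def by blast
  then interpret coxeter W R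
    using assms(1) by (intro coxeter.intro coxeter_axioms.intro)
  show ?thesis
    using excess_zero_nbrs_eqpoll[OF assms(3)] .
qed

end
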